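(* Let $n\ge1$, $D_n=\langle a,b\mid a^n=b^2=1,\ bab=a^{-1}\rangle$, and let $T^m$ be an inverse-closed multiset with underlying set $T\subseteq\langle a\rangle$. Then $\chi_h(T^m)$ is an integer for all $1\le h\le\lfloor\frac{n-1}{2}\rfloor$ if and only if $T^m\in C(\langle a\rangle)$. In particular, $\chi_h(T)$ is an integer for all $1\le h\le\lfloor\frac{n-1}{2}\rfloor$ if and only if $T\in B(\langle a\rangle)$.
   Context: A multiset $T^m$ is given by a multiplicity function $m:\langle a\rangle\to\mathbb{N}$ with support $T$; inverse-closed means $m(s)=m(s^{-1})$. $\chi_h(T^m)=\sum_s m(s)\chi_h(s)$, where $\chi_h(a^k)=2\cos(\frac{2kh\pi}{n})$. An atom is a set $[g]=\{x\in\langle a\rangle:\langle x\rangle=\langle g\rangle\}$. $B(\langle a\rangle)$ is the Boolean algebra of subsets of $\langle a\rangle$ generated by its subgroups under finite unions, intersections and complements (equivalently, unions of atoms). $C(\langle a\rangle)$ is the set of multisets $m_1*[g_1]\cup\cdots\cup m_k*[g_k]$ with $[g_i]$ atoms and $m_i\in\mathbb{N}$ (multiplicity constant on each atom). *)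

theory Defs
  imports Complex_Main "HOL-Library.Multiset" "HOL-Algebra.Generated_Groups"
begin

text \<open>
  A word is a list of letters \<open>(x, s)\<close> with \<open>x\<close> a generator; the letter stands for \<open>x\<close> if
  \<open>s\<close> is true and for the formal inverse of \<open>x\<close> otherwise. A relation \<open>(u, v)\<close> reads \<open>u = v\<close>.
\<close>

type_synonym 'g word = "('g \<times> bool) list"

inductive pres_eq :: "('g word \<times> 'g word) set \<Rightarrow> 'g word \<Rightarrow> 'g word \<Rightarrow> bool"
  for R where
  refl: "pres_eq R w w"
| sym: "pres_eq R u v \<Longrightarrow> pres_eq R v u"
| trans: "pres_eq R u v \<Longrightarrow> pres_eq R v w \<Longrightarrow> pres_eq R u w"
| append: "pres_eq R u u' \<Longrightarrow> pres_eq R v v' \<Longrightarrow> pres_eq R (u @ v) (u' @ v')"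
| cancel: "pres_eq R [(x, s), (x, \<not> s)] []"
| rel: "(u, v) \<in> R \<Longrightarrow> pres_eq R u v"

definition pres_class :: "('g word \<times> 'g word) set \<Rightarrow> 'g word \<Rightarrow> 'g word set" where
  "pres_class R w = {v. pres_eq R w v}"

definition presented_group :: "('g word \<times> 'g word) set \<Rightarrow> 'g word set monoid" where
  "presented_group R =
     \<lparr> carrier = range (pres_class R),
       monoid.mult = (\<lambda>X Y. \<Union>u\<in>X. \<Union>v\<in>Y. pres_class R (u @ v)),
       one = pres_class R [] \<rparr>"

lemma pres_class_eq_iff: "pres_class R u = pres_class R v \<longleftrightarrow> pres_eq R u v"
  unfolding pres_class_def set_eq_iff mem_Collect_eq
  by (meson pres_eq.refl pres_eq.sym pres_eq.trans)

lemma mult_pres_class: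
  "pres_class R u \<otimes>\<^bsub>presented_group R\<^esub> pres_class R v = pres_class R (u @ v)"
proof -
  have "pres_class R (u' @ v') = pres_class R (u @ v)"
    if "u' \<in> pres_class R u" "v' \<in> pres_class R v" for u' v'
    using that unfolding pres_class_eq_iff unfolding pres_class_def mem_Collect_eq
    by (intro pres_eq.sym[OF pres_eq.append])
  moreover have "u \<in> pres_class R u" "v \<in> pres_class R v"
    by (simp_all add: pres_class_def pres_eq.refl)
  ultimately have "(\<Union>u\<in>pres_class R u. \<Union>v\<in>pres_class R v. pres_class R (u @ v)) = pres_class R (u @ v)"
    by blast
  then show ?thesis
    by (simp add: presented_group_def)
qed

lemma one_presented_group: "\<one>\<^bsub>presented_group R\<^esub> = pres_class R []"
  by (simp add: presented_group_def)

lemma carrier_presented_group: "carrier (presented_group R) = range (pres_class R)"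
  by (simp add: presented_group_def)

definition inv_word :: "'g word \<Rightarrow> 'g word" where
  "inv_word w = rev (map (\<lambda>(x, s). (x, \<not> s)) w)"

lemma pres_eq_inv_word: "pres_eq R (inv_word w @ w) []"
proof (induction w)
  case Nil
  show ?case by (simp add: inv_word_def pres_eq.refl)
next
  case (Cons l w)
  obtain x s where l: "l = (x, s)" by force
  have "pres_eq R ([(x, \<not> s), (x, s)] @ w) ([] @ w)"
    using pres_eq.cancel[of R x "\<not> s"] by (intro pres_eq.append pres_eq.refl) simp
  then have "pres_eq R (inv_word w @ ([(x, \<not> s), (x, s)] @ w)) (inv_word w @ w)"
    by (intro pres_eq.append pres_eq.refl) simp
  then have "pres_eq R (inv_word w @ ([(x, \<not> s), (x, s)] @ w)) []"
    using Cons.IH by (rule pres_eq.trans)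
  then show ?case by (simp add: l inv_word_def)
qed

lemma group_presented_group: "group (presented_group R)"
proof (rule groupI)
  fix X assume "X \<in> carrier (presented_group R)"
  then obtain w where w: "X = pres_class R w" by (auto simp: carrier_presented_group)
  have "pres_class R (inv_word w) \<otimes>\<^bsub>presented_group R\<^esub> X = \<one>\<^bsub>presented_group R\<^esub>"
    by (simp add: w mult_pres_class one_presented_group pres_class_eq_iff pres_eq_inv_word)
  then show "\<exists>Y\<in>carrier (presented_group R). Y \<otimes>\<^bsub>presented_group R\<^esub> X = \<one>\<^bsub>presented_group R\<^esub>"
    by (auto simp: carrier_presented_group)
qed (auto simp: carrier_presented_group mult_pres_class one_presented_group)

datatype dihedral_gen = Rot | Refl

definition dihedral_rels :: "nat \<Rightarrow> (dihedral_gen word \<times> dihedral_gen word) set" where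
  "dihedral_rels n =
     {(replicate n (Rot, True), []),
      (replicate 2 (Refl, True), []),
      ([(Refl, True), (Rot, True), (Refl, True)], [(Rot, False)])}"

definition dihedral :: "nat \<Rightarrow> dihedral_gen word set monoid" where
  "dihedral n = presented_group (dihedral_rels n)"

definition rot :: "nat \<Rightarrow> dihedral_gen word set" where
  "rot n = pres_class (dihedral_rels n) [(Rot, True)]"

definition rotations :: "nat \<Rightarrow> dihedral_gen word set set" where
  "rotations n = generate (dihedral n) {rot n}"

text \<open>
  The character \<open>\<chi>\<^sub>h\<close> of the dihedral group. The choice of \<open>k\<close> does not matter, see
  \<open>dihedral_chi_rot_pow\<close> below. Only the values on rotations are used; the value \<open>0\<close>
  on the remaining elements is that of the two-dimensional character.
\<close>

definition dihedral_chi :: "nat \<Rightarrow> nat \<Rightarrow> dihedral_gen word set \<Rightarrow> real" where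
  "dihedral_chi n h g =
     (if g \<in> rotations n
      then let k = (SOME k :: nat. g = rot n [^]\<^bsub>dihedral n\<^esub> k)
           in 2 * cos (2 * real k * real h * pi / real n)
      else 0)"

fun dihedral_act :: "dihedral_gen word \<Rightarrow> int \<Rightarrow> int" where
  "dihedral_act [] x = x"
| "dihedral_act ((Rot, s) # w) x = dihedral_act w x + (if s then 1 else - 1)"
| "dihedral_act ((Refl, s) # w) x = - dihedral_act w x"

lemma dihedral_act_append: "dihedral_act (u @ v) x = dihedral_act u (dihedral_act v x)"
  by (induction u x rule: dihedral_act.induct) auto

lemma dihedral_act_replicate: "dihedral_act (replicate k (Rot, True)) x = x + int k"
  by (induction k) auto

lemma dihedral_act_cong:
  "int n dvd x - y \<Longrightarrow> int n dvd dihedral_act w x - dihedral_act w y"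
proof (induction w x rule: dihedral_act.induct)
  case (3 s w x)
  then have "int n dvd - (dihedral_act w x - dihedral_act w y)" by (simp only: dvd_minus_iff)
  then show ?case by (simp add: algebra_simps)
qed auto

lemma dihedral_act_pres_eq:
  "pres_eq (dihedral_rels n) u v \<Longrightarrow> int n dvd dihedral_act u x - dihedral_act v x"
proof (induction arbitrary: x rule: pres_eq.induct)
  case (sym u v)
  then show ?case by (metis dvd_minus_iff minus_diff_eq)
next
  case (trans u v w)
  have "int n dvd (dihedral_act u x - dihedral_act v x) + (dihedral_act v x - dihedral_act w x)"
    using trans.IH by (intro dvd_add)
  then show ?case by simp
next
  case (append u u' v v')
  have "int n dvd (dihedral_act u (dihedral_act v x) - dihedral_act u (dihedral_act v' x)) +
          (dihedral_act u (dihedral_act v' x) - dihedral_act u' (dihedral_act v' x))"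
    using append.IH by (intro dvd_add dihedral_act_cong)
  then show ?case by (simp add: dihedral_act_append)
next
  case (cancel y s)
  show ?case by (cases y) auto
next
  case (rel u v)
  then show ?case
    by (auto simp: dihedral_rels_def dihedral_act_replicate numeral_2_eq_2)
qed auto

lemma group_dihedral: "group (dihedral n)"
  by (simp add: dihedral_def group_presented_group)

lemma rot_in_carrier: "rot n \<in> carrier (dihedral n)"
  by (simp add: dihedral_def rot_def carrier_presented_group)

lemma rot_pow:
  "rot n [^]\<^bsub>dihedral n\<^esub> (k::nat) = pres_class (dihedral_rels n) (replicate k (Rot, True))"
proof (induction k)
  case 0
  then show ?case by (simp add: dihedral_def one_presented_group)
next
  case (Suc k)
  then show ?case
    by (simp add: dihedral_def rot_def mult_pres_class replicate_append_same)
qed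

lemma rot_pow_eqD:
  assumes "rot n [^]\<^bsub>dihedral n\<^esub> (k::nat) = rot n [^]\<^bsub>dihedral n\<^esub> (l::nat)"
  shows "int n dvd int k - int l"
  using dihedral_act_pres_eq[of n "replicate k (Rot, True)" "replicate l (Rot, True)" 0] assms
  by (simp add: rot_pow pres_class_eq_iff dihedral_act_replicate)

lemma dihedral_chi_rot_pow:
  assumes "n \<ge> 1"
  shows "dihedral_chi n h (rot n [^]\<^bsub>dihedral n\<^esub> (k::nat)) =
           2 * cos (2 * real k * real h * pi / real n)"
proof -
  interpret group "dihedral n" by (rule group_dihedral)
  let ?g = "rot n [^]\<^bsub>dihedral n\<^esub> k"
  define l where "l = (SOME l :: nat. ?g = rot n [^]\<^bsub>dihedral n\<^esub> l)"
  have "?g = rot n [^]\<^bsub>dihedral n\<^esub> l"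
    unfolding l_def by (rule someI) (rule HOL.refl)
  then obtain c where c: "int k - int l = int n * c"
    using rot_pow_eqD[of n k l] by (auto simp: dvd_def)
  then have "real_of_int (int k - int l) = real_of_int (int n * c)" by (rule arg_cong)
  then have "real k = real l + real n * real_of_int c" by simp
  then have "2 * real k * real h * pi / real n =
      2 * real l * real h * pi / real n + 2 * pi * real_of_int (c * int h)"
    using assms by (simp add: field_simps)
  then have "cos (2 * real k * real h * pi / real n) = cos (2 * real l * real h * pi / real n)"
    by (simp only: cos_add cos_int_2pin sin_int_2pin mult_1_right mult_zero_right diff_0_right)
  moreover have "?g \<in> rotations n"
    unfolding rotations_def
  proof (induction k)
    case 0
    show ?case by (simp add: generate.one)
  next
    case (Suc k)
    then show ?case by (simp add: generate.eng generate.incl)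
  qed
  ultimately show ?thesis
    by (simp add: dihedral_chi_def Let_def l_def)
qed

inductive_set subgroup_boolean_algebra :: "('a, 'b) monoid_scheme \<Rightarrow> 'a set \<Rightarrow> 'a set set"
  for G and H where
  subgroup: "subgroup K G \<Longrightarrow> K \<subseteq> H \<Longrightarrow> K \<in> subgroup_boolean_algebra G H"
| union: "X \<in> subgroup_boolean_algebra G H \<Longrightarrow> Y \<in> subgroup_boolean_algebra G H \<Longrightarrow>
    X \<union> Y \<in> subgroup_boolean_algebra G H"
| inter: "X \<in> subgroup_boolean_algebra G H \<Longrightarrow> Y \<in> subgroup_boolean_algebra G H \<Longrightarrow>
    X \<inter> Y \<in> subgroup_boolean_algebra G H"
| complement: "X \<in> subgroup_boolean_algebra G H \<Longrightarrow> H - X \<in> subgroup_boolean_algebra G H"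

definition atom_of :: "('a, 'b) monoid_scheme \<Rightarrow> 'a set \<Rightarrow> 'a \<Rightarrow> 'a set" where
  "atom_of G H g = {x \<in> H. generate G {x} = generate G {g}}"

definition atoms :: "('a, 'b) monoid_scheme \<Rightarrow> 'a set \<Rightarrow> 'a set set" where
  "atoms G H = atom_of G H ` H"

text \<open>
  The atoms in \<open>\<A>\<close> are distinct, hence disjoint, so the multiset sum is the union of the multisets
  \<open>m X * X\<close>. The notion is meant for finite \<open>H\<close>: \<^const>\<open>mset_set\<close> is empty on infinite sets.
\<close>

definition atom_cone :: "('a, 'b) monoid_scheme \<Rightarrow> 'a set \<Rightarrow> 'a multiset set" where
  "atom_cone G H =
     {M. \<exists>\<A> m. finite \<A> \<and> \<A> \<subseteq> atoms G H \<and> M = (\<Sum>X\<in>\<A>. repeat_mset (m X) (mset_set X))}"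

definition inverse_closed :: "('a, 'b) monoid_scheme \<Rightarrow> 'a multiset \<Rightarrow> bool" where
  "inverse_closed G M \<longleftrightarrow> (\<forall>s \<in> carrier G. count M (inv\<^bsub>G\<^esub> s) = count M s)"

end

theory Submission
  imports Defs "HOL-Number_Theory.Cong" "Jordan_Normal_Form.Char_Poly"
begin

text \<open>
  Up to a factor 2, \<open>\<chi>\<^sub>h(T\<^sup>m)\<close> is the discrete Fourier transform of the even function
  \<open>f(k) = m(a\<^sup>k)\<close> on \<open>\<int>/n\<close>, and the atoms of \<open>\<langle>a\<rangle>\<close> are the sets of all \<open>a\<^sup>k\<close> with a given
  \<open>gcd(k, n)\<close>. If \<open>f\<close> depends on \<open>gcd(k, n)\<close> only, its transform is an integer combination of
  Ramanujan sums, which are integers by inclusion-exclusion over the divisors of \<open>n\<close>.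

  Conversely, let the transform \<open>F\<close> be integer valued. For a prime \<open>p\<close>, the numbers \<open>F(h)\<^sup>p\<close> and
  \<open>F(ph)\<close> are congruent modulo \<open>p\<close> in \<open>\<int>[\<omega>]\<close>, hence so are the integers \<open>F(h)\<close> and \<open>F(ph)\<close>. As
  \<open>F\<close> is bounded, \<open>F(ph) = F(h)\<close> for all large \<open>p\<close>. Every unit modulo \<open>n\<close> is represented by a
  product of large primes, so that \<open>F\<close>, and by Fourier inversion \<open>f\<close>, is invariant under
  multiplication by units. This replaces the Galois theory of cyclotomic fields.
\<close>

subsection \<open>Algebraic integers in cyclotomic fields\<close>

text \<open>An eigenvalue of an integer matrix is a root of its characteristic polynomial, which is
  monic with integer coefficients. The entry \<open>v k\<close> certifies that the eigenvector is
  nonzero.\<close>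

lemma algebraic_int_if_int_matrix:
  fixes c :: complex and v :: "nat \<Rightarrow> complex" and A :: "nat \<Rightarrow> nat \<Rightarrow> int"
  assumes eigen: "\<And>i. i < n \<Longrightarrow> (\<Sum>j<n. of_int (A i j) * v j) = c * v i"
    and "k < n" "v k \<noteq> 0"
  shows "algebraic_int c"
proof -
  define B where "B = mat n n (\<lambda>(i, j). A i j)"
  have B: "B \<in> carrier_mat n n" by (simp add: B_def)
  let ?B = "map_mat complex_of_int B"
  have "?B *\<^sub>v vec n v = c \<cdot>\<^sub>v vec n v"
    using eigen by (intro eq_vecI) (auto simp: B_def scalar_prod_def atLeast0LessThan)
  moreover have "vec n v \<noteq> 0\<^sub>v n"
  proof
    assume "vec n v = 0\<^sub>v n"
    then have "vec n v $ k = 0\<^sub>v n $ k" by simp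
    with assms show False by simp
  qed
  ultimately have "eigenvalue ?B c"
    unfolding eigenvalue_def eigenvector_def using B by (intro exI[of _ "vec n v"]) auto
  then have "poly (char_poly ?B) c = 0"
    using B by (subst (asm) eigenvalue_root_char_poly[of _ n]) auto
  then have "poly (map_poly of_int (char_poly B)) c = 0"
    by (simp add: of_int_hom.char_poly_hom[OF B])
  moreover have "lead_coeff (char_poly B) = 1"
    using degree_monic_char_poly[OF B] by simp
  ultimately show ?thesis
    unfolding algebraic_int_altdef_ipoly by blast
qed

text \<open>Multiplication by \<open>Q(z)\<close> acts on the powers
  \<open>z^0, ..., z^(n-1)\<close> by an integer matrix: since \<open>z^n = 1\<close>, entry
  \<open>(i, j)\<close> collects the coefficients of \<open>Q\<close> at all \<open>m\<close> with
  \<open>m + i\<close> congruent to \<open>j\<close> modulo \<open>n\<close>. The vector of powers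
  is an eigenvector with eigenvalue \<open>Q(z)\<close>, and its entry at 0 is 1.\<close>

lemma algebraic_int_poly_root_of_unity:
  fixes z :: complex
  assumes "n > 0" "z ^ n = 1"
  shows "algebraic_int (poly (map_poly of_int Q) z)"
proof (rule algebraic_int_if_int_matrix)
  have mod: "z ^ (m mod n) = z ^ m" for m
    using assms(2) by (metis div_mult_mod_eq mult.commute mult_1 power_add power_mult power_one)
  fix i assume "i < n"
  have "(\<Sum>j<n. of_int (\<Sum>m \<in> {m. m \<le> degree Q \<and> (m + i) mod n = j}. coeff Q m) * z ^ j) =
      (\<Sum>j<n. \<Sum>m \<in> {m \<in> {..degree Q}. (m + i) mod n = j}. of_int (coeff Q m) * z ^ (m + i))"
    by (intro sum.cong HOL.refl) (auto simp: sum_distrib_right mod intro!: sum.cong)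
  also have "\<dots> = (\<Sum>m\<le>degree Q. of_int (coeff Q m) * z ^ (m + i))"
    using assms(1) by (intro sum.group) auto
  also have "\<dots> = poly (map_poly of_int Q) z * z ^ i"
    by (simp add: poly_altdef sum_distrib_right power_add mult.assoc)
  finally show "(\<Sum>j<n. of_int (\<Sum>m \<in> {m. m \<le> degree Q \<and> (m + i) mod n = j}. coeff Q m) * z ^ j) =
      poly (map_poly of_int Q) z * z ^ i" .
qed (use assms in auto)

text \<open>The Frobenius congruence: \<open>p\<close> divides all inner binomial coefficients, and
  induction extends this from two summands to finite sums. The ring is left general because both the
  integers and the integer polynomials are used later.\<close>

lemma prime_dvd_sum_power:
  fixes z :: "'b \<Rightarrow> 'a :: comm_ring_1"
  assumes "prime p"
  shows "of_nat p dvd (\<Sum>i\<in>A. z i) ^ p - (\<Sum>i\<in>A. z i ^ p)"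
proof -
  have p: "p > 0" using assms prime_gt_0_nat by blast
  have add: "of_nat p dvd (x + y) ^ p - (x ^ p + y ^ p)" for x y :: 'a
  proof -
    have "(x + y) ^ p = (\<Sum>k\<le>p. of_nat (p choose k) * x ^ k * y ^ (p - k))"
      by (rule binomial_ring)
    also have "\<dots> = (\<Sum>k\<in>{..p} - {0, p}. of_nat (p choose k) * x ^ k * y ^ (p - k)) +
        (\<Sum>k\<in>{0, p}. of_nat (p choose k) * x ^ k * y ^ (p - k))"
      by (rule sum.subset_diff) auto
    also have "(\<Sum>k\<in>{0, p}. of_nat (p choose k) * x ^ k * y ^ (p - k)) = x ^ p + y ^ p"
      using p by simp
    finally have "(x + y) ^ p - (x ^ p + y ^ p) =
        (\<Sum>k\<in>{..p} - {0, p}. of_nat (p choose k) * x ^ k * y ^ (p - k))"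
      by simp
    moreover have "of_nat p dvd (of_nat (p choose k) :: 'a)" if "k \<in> {..p} - {0, p}" for k
    proof -
      have "p dvd p choose k" using that assms by (intro dvd_choose_prime) auto
      then show ?thesis by (metis dvd_def of_nat_mult)
    qed
    ultimately show ?thesis
      by (auto intro!: dvd_sum dvd_mult2)
  qed
  show ?thesis
  proof (induction A rule: infinite_finite_induct)
    case (insert a A)
    have "of_nat p dvd ((z a + sum z A) ^ p - (z a ^ p + sum z A ^ p)) +
        (sum z A ^ p - (\<Sum>i\<in>A. z i ^ p))"
      by (intro dvd_add add insert.IH)
    with insert.hyps show ?case by (simp add: algebra_simps)
  qed (use p in \<open>auto simp: power_0_left\<close>)
qed

text \<open>The Frobenius congruence for a sum of \<open>b\<close> ones, where \<open>b\<close> is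
  the nonnegative residue of \<open>a\<close> modulo \<open>p\<close>.\<close>

lemma fermat_int:
  fixes a :: int
  assumes "prime p"
  shows "int p dvd a ^ p - a"
proof -
  have p: "p > 0" using assms prime_gt_0_nat by blast
  define b where "b = nat (a mod int p)"
  have b: "int b = a mod int p" using p by (simp add: b_def)
  have "int p dvd (\<Sum>i\<in>{..<b}. 1) ^ p - (\<Sum>i\<in>{..<b}. 1 ^ p)"
    by (rule prime_dvd_sum_power[OF assms])
  then have "[int b ^ p = int b] (mod int p)"
    by (simp add: cong_iff_dvd_diff)
  moreover have "[a = int b] (mod int p)"
    by (simp add: b)
  ultimately have "[a ^ p = a] (mod int p)"
    by (metis cong_pow cong_sym cong_trans)
  then show ?thesis by (simp add: cong_iff_dvd_diff)
qed

subsection \<open>Integer-valued Fourier transforms on cyclic groups\<close>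

definition root_unity :: "nat \<Rightarrow> complex" where
  "root_unity n = cis (2 * pi / real n)"

lemma root_unity_power: "root_unity n ^ k = cis (2 * pi * real k / real n)"
  by (simp add: root_unity_def DeMoivre mult_ac)

lemma root_unity_power_self: "n > 0 \<Longrightarrow> root_unity n ^ n = 1"
  by (simp add: root_unity_power)

lemma root_unity_power_cong:
  assumes "n > 0" "[k = l] (mod n)"
  shows "root_unity n ^ k = root_unity n ^ l"
proof -
  have "root_unity n ^ (m mod n) = root_unity n ^ m" for m
    using root_unity_power_self[OF assms(1)]
    by (metis div_mult_mod_eq mult.commute mult_1 power_add power_mult power_one)
  then show ?thesis using assms(2) by (metis cong_def)
qed

lemma root_unity_power_eq_1_iff:
  assumes "n > 0"
  shows "root_unity n ^ k = 1 \<longleftrightarrow> n dvd k"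
proof
  assume "root_unity n ^ k = 1"
  then have "cos (2 * pi * real k / real n) = 1"
    by (simp add: root_unity_power complex_eq_iff)
  then obtain x :: int where "2 * pi * real k / real n = real_of_int x * 2 * pi"
    using cos_one_2pi_int by blast
  then have "real k = real_of_int x * real n"
    using assms by (simp add: field_simps)
  then have "real_of_int (int k) = real_of_int (x * int n)" by simp
  then have "int k = x * int n" by (simp only: of_int_eq_iff)
  then have "int n dvd int k" by simp
  then show "n dvd k" by simp
next
  assume "n dvd k"
  then show "root_unity n ^ k = 1"
    using root_unity_power_cong[OF assms, of k 0] by (simp add: cong_0_iff)
qed

lemma sum_root_unity_power:
  assumes "n > 0"
  shows "(\<Sum>k<n. root_unity n ^ (k * h)) = (if n dvd h then of_nat n else 0)"
proof (cases "n dvd h")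
  case True
  then have "root_unity n ^ (k * h) = 1" for k
    by (simp add: root_unity_power_eq_1_iff[OF assms])
  with True show ?thesis by simp
next
  case False
  then have "root_unity n ^ h \<noteq> 1" by (simp add: root_unity_power_eq_1_iff[OF assms])
  moreover have "(root_unity n ^ h) ^ n = 1"
    by (simp add: root_unity_power_eq_1_iff[OF assms] flip: power_mult)
  moreover have "(\<Sum>k<n. root_unity n ^ (k * h)) = (\<Sum>k<n. (root_unity n ^ h) ^ k)"
    by (simp add: mult.commute flip: power_mult)
  ultimately show ?thesis using False by (simp add: geometric_sum)
qed

text \<open>Multiplication by a unit modulo \<open>n\<close> is injective on residues, hence
  permutes them.\<close>

lemma sum_mult_coprime:
  fixes g :: "nat \<Rightarrow> 'a :: comm_monoid_add"
  assumes "n > 0" "coprime q n" and per: "\<And>k. g (k mod n) = g k"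
  shows "(\<Sum>k<n. g (q * k)) = (\<Sum>k<n. g k)"
proof -
  have inj: "inj_on (\<lambda>k. q * k mod n) {..<n}"
  proof (rule inj_onI)
    fix k l assume "k \<in> {..<n}" "l \<in> {..<n}" "q * k mod n = q * l mod n"
    then have "[q * k = q * l] (mod n)" by (simp add: cong_def)
    then have "[k = l] (mod n)" using assms(2) cong_mult_lcancel_nat by blast
    with \<open>k \<in> _\<close> \<open>l \<in> _\<close> show "k = l" by (simp add: cong_def)
  qed
  moreover have "(\<lambda>k. q * k mod n) ` {..<n} = {..<n}"
    using inj assms(1) by (intro card_subset_eq) (auto simp: card_image)
  ultimately have "(\<Sum>k<n. g (q * k mod n)) = (\<Sum>k<n. g k)"
    by (intro sum.reindex_bij_betw) (simp add: bij_betw_def)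
  then show ?thesis by (simp add: per)
qed

definition dft :: "nat \<Rightarrow> (nat \<Rightarrow> int) \<Rightarrow> nat \<Rightarrow> complex" where
  "dft n f h = (\<Sum>k<n. of_int (f k) * root_unity n ^ (k * h))"

lemma dft_cong:
  assumes "n > 0" "[h = h'] (mod n)"
  shows "dft n f h = dft n f h'"
  unfolding dft_def using assms
  by (intro sum.cong HOL.refl arg_cong2[where f = "(*)"] root_unity_power_cong cong_mult) auto

text \<open>The factor \<open>n - 1\<close> stands for -1 modulo \<open>n\<close>. The substitution
  of \<open>-k\<close> for \<open>k\<close> moves the sign from \<open>h\<close> to the argument of
  \<open>f\<close>, where evenness absorbs it.\<close>

lemma dft_neg:
  assumes "n > 0" and per: "\<And>k. f (k mod n) = f k" and neg: "\<And>k. f ((n - 1) * k) = f k"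
  shows "dft n f ((n - 1) * h) = dft n f h"
proof -
  have "dft n f ((n - 1) * h) = (\<Sum>k<n. of_int (f ((n - 1) * k)) * root_unity n ^ ((n - 1) * k * h))"
    unfolding dft_def neg by (simp add: mult_ac)
  also have "\<dots> = dft n f h"
    unfolding dft_def using assms(1) coprime_diff_one_left_nat[OF assms(1)]
    by (intro sum_mult_coprime[where g = "\<lambda>k. of_int (f k) * root_unity n ^ (k * h)"]
        arg_cong2[where f = "(*)"] root_unity_power_cong cong_mult)
      (simp_all add: per)
  finally show ?thesis .
qed

text \<open>Exchanging the sums and using orthogonality leaves the single index \<open>j\<close>
  congruent to \<open>k\<close>. The exponent \<open>(n - 1) * k\<close> represents
  \<open>-k\<close>.\<close>

lemma dft_inversion:
  assumes "n > 0" and per: "\<And>k. f (k mod n) = f k"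
  shows "(\<Sum>h<n. dft n f h * root_unity n ^ (h * ((n - 1) * k))) = of_nat n * of_int (f k)"
proof -
  have "(\<Sum>h<n. dft n f h * root_unity n ^ (h * ((n - 1) * k))) =
      (\<Sum>h<n. \<Sum>j<n. of_int (f j) * root_unity n ^ (h * (j + (n - 1) * k)))"
    unfolding dft_def sum_distrib_right
    by (intro sum.cong HOL.refl) (simp add: distrib_left power_add mult_ac)
  also have "\<dots> = (\<Sum>j<n. of_int (f j) * (\<Sum>h<n. root_unity n ^ (h * (j + (n - 1) * k))))"
    by (subst sum.swap) (simp add: sum_distrib_left)
  also have "\<dots> = (\<Sum>j<n. if j = k mod n then of_nat n * of_int (f k) else 0)"
  proof (rule sum.cong[OF HOL.refl])
    fix j assume "j \<in> {..<n}"
    have "n dvd j + (n - 1) * k \<longleftrightarrow> int n dvd int (j + (n - 1) * k)"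
      by (simp only: int_dvd_int_iff)
    also have "int (j + (n - 1) * k) = int n * int k + (int j - int k)"
      using assms(1) by (cases n) (simp_all add: algebra_simps)
    also have "int n dvd \<dots> \<longleftrightarrow> [int j = int k] (mod int n)"
      unfolding cong_iff_dvd_diff by (rule dvd_add_right_iff) simp
    also have "\<dots> \<longleftrightarrow> j = k mod n"
      using \<open>j \<in> _\<close> unfolding cong_int_iff by (simp add: cong_def)
    finally show "of_int (f j) * (\<Sum>h<n. root_unity n ^ (h * (j + (n - 1) * k))) =
        (if j = k mod n then of_nat n * of_int (f k) else 0)"
      by (auto simp: sum_root_unity_power[OF assms(1)] per)
  qed
  also have "\<dots> = of_nat n * of_int (f k)"
    using assms(1) by simp
  finally show ?thesis .
qed

lemma norm_dft_le: "norm (dft n f h) \<le> real_of_int (\<Sum>k<n. \<bar>f k\<bar>)"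
proof -
  have "norm (dft n f h) \<le> (\<Sum>k<n. norm (of_int (f k) * root_unity n ^ (k * h)))"
    unfolding dft_def by (rule norm_sum)
  also have "\<dots> = real_of_int (\<Sum>k<n. \<bar>f k\<bar>)"
    by (simp add: norm_mult norm_power root_unity_def)
  finally show ?thesis .
qed

text \<open>
  Modulo a prime \<open>p\<close>, raising \<open>dft n f h\<close> to the power \<open>p\<close> yields \<open>dft n f (p * h)\<close>. Two
  integers that are congruent modulo \<open>p\<close> in the ring of algebraic integers are congruent in
  \<open>\<int>\<close>, and a large \<open>p\<close> leaves no room for them to differ.
\<close>
lemma dft_mult_prime:
  assumes "n > 0" "prime p" and p: "2 * (\<Sum>k<n. \<bar>f k\<bar>) < int p"
    and int: "\<And>h. dft n f h \<in> \<int>"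
  shows "dft n f (p * h) = dft n f h"
proof -
  define z where "z = root_unity n ^ h"
  \<comment> \<open>Elements of \<open>\<int>[z]\<close> are handled as values at \<open>z\<close>
    of integer polynomials, so that congruences modulo \<open>p\<close> can be proved among
    polynomials and then evaluated.\<close>
  define E where "E Q = poly (map_poly of_int Q) z" for Q :: "int poly"
  have z: "z ^ n = 1"
    by (simp add: z_def root_unity_power_eq_1_iff[OF assms(1)] flip: power_mult)
  have E_monom: "E (monom a k) = of_int a * z ^ k" for a k
    by (simp add: E_def poly_monom map_poly_monom)
  have E_simps: "E (P + Q) = E P + E Q" "E (P - Q) = E P - E Q" "E (P * Q) = E P * E Q"
    "E (P ^ k) = E P ^ k" "E (sum g A) = (\<Sum>i\<in>A. E (g i))" for P Q k and g :: "nat \<Rightarrow> int poly" and A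
    by (simp_all add: E_def of_int_poly_hom.hom_add of_int_poly_hom.hom_minus
        of_int_poly_hom.hom_mult of_int_poly_hom.hom_power of_int_poly_hom.hom_sum poly_sum)
  have E_of_int: "E (of_int a) = of_int a" "E (of_nat k) = of_nat k" for a k
    using E_monom[of a 0] E_monom[of "int k" 0]
    by (simp_all add: monom_0 of_int_poly flip: of_nat_poly)
  define P where "P = (\<Sum>k<n. monom (f k) k)"
  have EP: "E P = dft n f h"
    by (simp add: P_def E_simps E_monom dft_def z_def mult.commute flip: power_mult)
  obtain c d where c: "dft n f h = of_int c" and d: "dft n f (p * h) = of_int d"
    using int by (metis Ints_cases)
  obtain Q where "P ^ p - (\<Sum>k<n. monom (f k) k ^ p) = of_nat p * Q"
    using prime_dvd_sum_power[OF assms(2), of "\<lambda>k. monom (f k) k" "{..<n}"]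
    unfolding P_def dvd_def by blast
  then have "E (P ^ p - (\<Sum>k<n. monom (f k) k ^ p)) = E (of_nat p * Q)"
    by (rule arg_cong)
  then have Q: "of_int c ^ p - (\<Sum>k<n. of_int (f k ^ p) * z ^ (k * p)) = of_nat p * E Q"
    unfolding E_simps EP E_of_int c E_monom power_mult_distrib of_int_power power_mult .
  have "\<exists>r. f k ^ p - f k = int p * r" for k
    using fermat_int[OF assms(2)] by (auto simp: dvd_def)
  then obtain r where "\<And>k. f k ^ p - f k = int p * r k" by metis
  then have r: "f k ^ p = f k + int p * r k" for k by (simp add: algebra_simps)
  obtain t where "c ^ p - c = int p * t"
    using fermat_int[OF assms(2)] by (auto simp: dvd_def)
  then have t: "c ^ p = c + int p * t" by simp
  \<comment> \<open>Fermat's theorem replaces \<open>c^p\<close> by \<open>c + p * t\<close> and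
    \<open>f k ^ p\<close> by \<open>f k + p * r k\<close>. Collecting all multiples of
    \<open>p\<close> gives the quotient of \<open>c - d\<close> by \<open>p\<close> as the value of
    an integer polynomial.\<close>
  define Q' where "Q' = Q - of_int t + (\<Sum>k<n. monom (r k) (k * p))"
  have "dft n f (p * h) = (\<Sum>k<n. of_int (f k) * z ^ (k * p))"
    by (simp add: dft_def z_def mult_ac flip: power_mult)
  then have d': "of_int d = (\<Sum>k<n. of_int (f k) * z ^ (k * p))"
    using d by simp
  have "of_int c - of_int d = of_nat p * E Q'"
  proof -
    have "(\<Sum>k<n. of_int (f k ^ p) * z ^ (k * p)) =
        of_int d + of_nat p * (\<Sum>k<n. of_int (r k) * z ^ (k * p))"
      by (simp add: r d' algebra_simps sum.distrib sum_distrib_left)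
    moreover have "of_int c ^ p = of_int c + of_nat p * (of_int t :: complex)"
      using arg_cong[OF t, of complex_of_int] by simp
    ultimately show ?thesis
      using Q by (simp add: Q'_def E_simps E_of_int E_monom algebra_simps)
  qed
  moreover have "p > 0" using assms(2) prime_gt_0_nat by blast
  \<comment> \<open>The quotient is rational and an algebraic integer, hence an integer. So
    \<open>p\<close> divides \<open>c - d\<close> in the integers.\<close>
  ultimately have EQ': "E Q' = of_int (c - d) / of_nat p"
    by (simp add: field_simps)
  then have "E Q' \<in> \<rat>" by simp
  moreover have "algebraic_int (E Q')"
    unfolding E_def using algebraic_int_poly_root_of_unity[OF assms(1) z] .
  ultimately obtain e where "E Q' = of_int e"
    using rational_algebraic_int_is_int Ints_cases by metis
  with EQ' \<open>p > 0\<close> have "complex_of_int (c - d) = of_int (int p * e)"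
    by (simp add: field_simps)
  then have "c - d = int p * e" by (simp only: of_int_eq_iff)
  moreover have "\<bar>c\<bar> \<le> (\<Sum>k<n. \<bar>f k\<bar>)" "\<bar>d\<bar> \<le> (\<Sum>k<n. \<bar>f k\<bar>)"
    using norm_dft_le[of n f h] norm_dft_le[of n f "p * h"] unfolding c d
    by (simp_all only: norm_of_int of_int_le_iff flip: of_int_abs)
  then have "\<bar>c - d\<bar> < int p" using p by linarith
  ultimately have "c - d = 0"
    by (metis dvd_imp_le_int dvd_triv_left abs_of_nat linorder_not_less)
  then show ?thesis by (simp add: c d)
qed

text \<open>Induction on \<open>q\<close>, stripping one prime factor at a time.\<close>

lemma dft_mult_large_primes:
  assumes "n > 0" "q > 0" and q: "\<And>p. prime p \<Longrightarrow> p dvd q \<Longrightarrow> 2 * (\<Sum>k<n. \<bar>f k\<bar>) < int p"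
    and int: "\<And>h. dft n f h \<in> \<int>"
  shows "dft n f (q * h) = dft n f h"
  using assms(2) q
proof (induction q rule: less_induct)
  case (less q)
  show ?case
  proof (cases "q = 1")
    case False
    then obtain p where "prime p" "p dvd q" using prime_factor_nat by blast
    then obtain q' where q': "q = p * q'" by (auto simp: dvd_def)
    have "p > 1" using \<open>prime p\<close> prime_gt_1_nat by blast
    with less.prems(1) q' have "q' > 0" "q' < q" by auto
    then have "dft n f (q' * h) = dft n f h"
      using less.prems(2) q' by (intro less.IH) auto
    moreover have "dft n f (p * (q' * h)) = dft n f (q' * h)"
      using \<open>prime p\<close> \<open>p dvd q\<close> by (intro dft_mult_prime assms(1) less.prems int)
    ultimately show ?thesis by (simp add: q' mult.assoc)
  qed simp
qed

text \<open>
  An elementary substitute for Dirichlet's theorem on primes in arithmetic progressions.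
\<close>
lemma ex_cong_large_primes:
  fixes i m B :: nat
  assumes "coprime i m" "m > 0"
  obtains q where "q > 0" "[q = i] (mod m)" "\<And>p. prime p \<Longrightarrow> p dvd q \<Longrightarrow> p > B"
proof -
  \<comment> \<open>Each prime \<open>p \<le> B\<close> divides exactly one of the summands
    \<open>i\<close> and \<open>m * \<Prod>S\<close>: if it divides \<open>i\<close>, it divides
    neither \<open>m\<close>, by coprimality, nor \<open>\<Prod>S\<close>; otherwise it lies in
    \<open>S\<close>. Hence it does not divide the sum \<open>q\<close>.\<close>
  define S where "S = {p. prime p \<and> p \<le> B \<and> \<not> p dvd i}"
  define q where "q = i + m * \<Prod>S"
  have fin: "finite S" by (rule finite_subset[of _ "{..B}"]) (auto simp: S_def)
  have dvd_S: "p dvd \<Prod>S \<longleftrightarrow> p \<in> S" if p: "prime p" "p \<le> B" for p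
  proof
    assume "p dvd \<Prod>S"
    then obtain r where "r \<in> S" "p dvd r"
      using prime_dvd_prod_iff[OF fin, of p "\<lambda>x. x"] p(1) by auto
    then show "p \<in> S" using p primes_dvd_imp_eq by (auto simp: S_def)
  qed (use fin in \<open>auto intro: dvd_prodI\<close>)
  have "\<Prod>S > 0" by (rule prod_pos) (auto simp: S_def prime_gt_0_nat)
  with assms(2) have "q > 0" by (simp add: q_def)
  moreover have "[q = i] (mod m)" by (simp add: q_def cong_def)
  moreover have "p > B" if "prime p" "p dvd q" for p
  proof (rule ccontr)
    assume "\<not> p > B"
    then have p: "p \<le> B" by simp
    show False
    proof (cases "p dvd i")
      case True
      with that(2) have "p dvd m * \<Prod>S" by (simp add: q_def dvd_add_right_iff)
      moreover have "\<not> p dvd m"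
        using True that(1) assms(1) coprime_common_divisor not_prime_unit by metis
      ultimately have "p \<in> S" using that(1) p dvd_S by (simp add: prime_dvd_mult_iff)
      with True show False by (simp add: S_def)
    next
      case False
      then have "p dvd m * \<Prod>S" using that(1) p dvd_S by (simp add: S_def)
      with that(2) have "p dvd i" by (simp add: q_def dvd_add_left_iff)
      with False show False by simp
    qed
  qed
  ultimately show ?thesis using that by blast
qed

text \<open>After division by the common gcd \<open>d\<close>, both \<open>k'\<close> and
  \<open>l'\<close> are units modulo \<open>n' = n / d\<close>, so \<open>q\<close> only has to
  represent the unit \<open>l' / k'\<close> modulo \<open>n'\<close>, and
  \<open>ex_cong_large_primes\<close> applies.\<close>

lemma ex_mult_cong_large_primes:
  fixes k l n B :: nat
  assumes "n > 0" "gcd k n = gcd l n"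
  obtains q where "q > 0" "[q * k = l] (mod n)" "\<And>p. prime p \<Longrightarrow> p dvd q \<Longrightarrow> p > B"
proof -
  define d where "d = gcd k n"
  have d: "d > 0" using assms(1) by (simp add: d_def)
  obtain k' n' where k': "k = k' * d" "n = n' * d" "coprime k' n'"
    using gcd_coprime_exists[of k n] d unfolding d_def by auto
  obtain l' n'' where l': "l = l' * d" "n = n'' * d" "coprime l' n''"
    using gcd_coprime_exists[of l n] d unfolding d_def assms(2) by auto
  have n'': "n'' = n'" using k' l' d by simp
  obtain x where x: "[k' * x = 1] (mod n')" using cong_solve_coprime_nat[OF k'(3)] by auto
  then have "coprime x n'" by (metis coprime_iff_invertible_nat mult.commute One_nat_def)
  moreover have "n' > 0" using k' assms(1) by (cases n') auto
  ultimately obtain q where q: "q > 0" "[q = x * l'] (mod n')" "\<And>p. prime p \<Longrightarrow> p dvd q \<Longrightarrow> p > B"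
    using l'(3) ex_cong_large_primes[of "x * l'" n' B] by (auto simp: n'')
  have "[q * k' = (x * l') * k'] (mod n')" using q(2) by (rule cong_mult) simp
  also have "[(x * l') * k' = 1 * l'] (mod n')"
    using cong_mult[OF x cong_refl[of l']] by (simp add: mult_ac)
  finally have "[q * k = l] (mod n)"
    unfolding k' l'(1) using d by (simp add: cong_def mod_mult_mult2 flip: mult.assoc)
  with q show ?thesis using that by blast
qed

text \<open>With \<open>F = dft n f\<close> and \<open>w = root_unity n\<close>,
  \<open>n * f (q * k)\<close> is the sum of \<open>F(h) * w^(-q*h*k)\<close>. Invariance turns
  \<open>F(h)\<close> into \<open>F(q * h)\<close>, and reindexing by the unit \<open>q\<close>
  gives the sum for \<open>n * f k\<close>. Choosing \<open>q\<close> with \<open>q * k\<close>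
  congruent to \<open>l\<close> finishes the proof.\<close>

lemma eq_if_dft_int:
  assumes "n > 0" and per: "\<And>k. f (k mod n) = f k" and int: "\<And>h. dft n f h \<in> \<int>"
    and "gcd k n = gcd l n"
  shows "f k = f l"
proof -
  \<comment> \<open>The bound \<open>n\<close> forces \<open>q\<close> to be coprime to
    \<open>n\<close>, as all prime factors of \<open>q\<close> exceed \<open>n\<close>; the other
    bound makes \<open>dft_mult_large_primes\<close> applicable.\<close>
  define B where "B = max n (nat (2 * (\<Sum>k<n. \<bar>f k\<bar>)))"
  obtain q where q: "q > 0" "[q * k = l] (mod n)" "\<And>p. prime p \<Longrightarrow> p dvd q \<Longrightarrow> p > B"
    using ex_mult_cong_large_primes[OF assms(1,4)] by blast
  have "coprime q n"
  proof (rule ccontr)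
    assume "\<not> coprime q n"
    then obtain p where "prime p" "p dvd q" "p dvd n"
      by (metis coprime_iff_gcd_eq_1 gcd_nat.bounded_iff prime_factor_nat)
    with q(3) have "p > n" unfolding B_def by fastforce
    with \<open>p dvd n\<close> assms(1) show False using dvd_imp_le by fastforce
  qed
  have inv: "dft n f (q * h) = dft n f h" for h
  proof (rule dft_mult_large_primes[OF assms(1) q(1) _ int])
    fix p assume "prime p" "p dvd q"
    then have "p > B" by (rule q(3))
    then show "2 * (\<Sum>k<n. \<bar>f k\<bar>) < int p" unfolding B_def by linarith
  qed
  define g where "g = (\<lambda>h. dft n f h * root_unity n ^ (h * ((n - 1) * k)))"
  have "of_nat n * of_int (f k) = (\<Sum>h<n. g h)"
    unfolding g_def using dft_inversion[OF assms(1), of f k] per by simp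
  have "of_nat n * of_int (f (q * k)) = 
     (\<Sum>h<n. dft n f h * root_unity n ^ (h * ((n - 1) * (q * k))))"
    using dft_inversion[of n f "q * k"] assms(1) per by simp
  also have "\<dots> = (\<Sum>h<n. g (q * h))"
    unfolding g_def inv by (simp add: mult_ac)
  also have "\<dots> = (\<Sum>h<n. g h)"
    using \<open>coprime q n\<close> unfolding g_def
    by (intro sum_mult_coprime assms(1) arg_cong2[where f = "(*)"] dft_cong root_unity_power_cong
        cong_mult) auto
  also have "\<dots> = of_nat n * of_int (f k)"
    unfolding g_def using dft_inversion[of n f k] assms(1) per by simp
  finally have "complex_of_int (f (q * k)) = of_int (f k)" using assms(1) by simp
  then have "f (q * k) = f k" by simp
  moreover have "f (q * k) = f l" using q(2) per by (metis cong_def)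
  ultimately show ?thesis by simp
qed

section \<open>Ramanujan sums and integrality of the transform\<close>

lemma sum_root_unity_multiples:
  assumes "n > 0" "d dvd n"
  shows "(\<Sum>k | k < n \<and> d dvd k. root_unity n ^ (k * h)) \<in> \<int>"
proof -
  obtain m where m: "n = d * m" using assms(2) by (auto simp: dvd_def)
  have d: "d > 0" and m0: "m > 0" using m assms(1) by auto
  \<comment> \<open>Since \<open>root_unity n ^ d = root_unity m\<close>, the sum over multiples of
    \<open>d\<close> becomes a full sum over the powers of \<open>root_unity m\<close>.\<close>
  have "bij_betw (\<lambda>k. d * k) {..<m} {k. k < n \<and> d dvd k}"
    using d unfolding m by (intro bij_betwI[where g = "\<lambda>k. k div d"]) auto
  then have "(\<Sum>k | k < n \<and> d dvd k. root_unity n ^ (k * h)) = (\<Sum>k<m. root_unity n ^ (d * k * h))"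
    by (rule sum.reindex_bij_betw[symmetric])
  also have "\<dots> = (\<Sum>k<m. root_unity m ^ (k * h))"
    using d m0 by (simp add: root_unity_power m field_simps)
  finally show ?thesis by (simp add: sum_root_unity_power[OF m0])
qed

text \<open>The multiples of \<open>d\<close> below \<open>n\<close> are sorted by their gcd with
  \<open>n\<close>. All classes other than that of \<open>d\<close> itself belong to proper
  multiples \<open>e\<close> of \<open>d\<close>, for which \<open>n div e\<close> is smaller, and
  are subtracted by induction.\<close>

lemma sum_root_unity_gcd:
  assumes "n > 0" "d dvd n"
  shows "(\<Sum>k | k < n \<and> gcd k n = d. root_unity n ^ (k * h)) \<in> \<int>"
  using assms(2)
proof (induction "n div d" arbitrary: d rule: less_induct)
  case less
  define T where "T = {e. e dvd n \<and> d dvd e \<and> e \<noteq> d}"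
  let ?A = "\<lambda>e. {k. k < n \<and> gcd k n = e}"
  have fin: "finite T"
    using assms(1) by (intro finite_subset[OF _ finite_divisors_nat[of n]]) (auto simp: T_def)
  have "(\<Sum>k | k < n \<and> d dvd k. root_unity n ^ (k * h)) =
      (\<Sum>e\<in>insert d T. \<Sum>k\<in>{k \<in> {k. k < n \<and> d dvd k}. gcd k n = e}. root_unity n ^ (k * h))"
    using fin less.prems by (intro sum.group[symmetric]) (auto simp: T_def)
  also have "\<dots> = (\<Sum>e\<in>insert d T. \<Sum>k\<in>?A e. root_unity n ^ (k * h))"
    by (intro sum.cong HOL.refl) (auto simp: T_def)
  also have "\<dots> = (\<Sum>k\<in>?A d. root_unity n ^ (k * h)) + (\<Sum>e\<in>T. \<Sum>k\<in>?A e. root_unity n ^ (k * h))"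
    using fin by (subst sum.insert) (auto simp: T_def)
  finally have "(\<Sum>k\<in>?A d. root_unity n ^ (k * h)) =
      (\<Sum>k | k < n \<and> d dvd k. root_unity n ^ (k * h)) - (\<Sum>e\<in>T. \<Sum>k\<in>?A e. root_unity n ^ (k * h))"
    by simp
  moreover have "(\<Sum>k\<in>?A e. root_unity n ^ (k * h)) \<in> \<int>" if e: "e \<in> T" for e
  proof (rule less.hyps)
    have "d < e" using e assms(1) unfolding T_def
      by (metis (mono_tags, lifting) dvd_imp_le dvd_pos_nat mem_Collect_eq nat_less_le)
    moreover obtain a b where "n = e * a" "e = d * b"
      using e unfolding T_def by (auto simp: dvd_def)
    ultimately show "n div e < n div d"
      using assms(1) by (cases "d = 0") (auto simp: mult.assoc)
  qed (use e in \<open>auto simp: T_def\<close>)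
  ultimately show ?case
    using sum_root_unity_multiples[OF assms(1) less.prems]
    by (simp only:) (intro Ints_diff Ints_sum[of T])
qed

lemma dft_int_if_gcd:
  assumes "n > 0" and f: "\<And>k l. gcd k n = gcd l n \<Longrightarrow> f k = f l"
  shows "dft n f h \<in> \<int>"
proof -
  have "dft n f h = (\<Sum>d\<in>{d. d dvd n}. \<Sum>k\<in>{k \<in> {..<n}. gcd k n = d}. of_int (f k) * root_unity n ^ (k * h))"
    unfolding dft_def using assms(1) by (intro sum.group[symmetric]) auto
  also have "\<dots> = (\<Sum>d\<in>{d. d dvd n}. of_int (f d) * (\<Sum>k | k < n \<and> gcd k n = d. root_unity n ^ (k * h)))"
  proof (intro sum.cong HOL.refl)
    fix d assume "d \<in> {d. d dvd n}"
    \<comment> \<open>A divisor \<open>d\<close> of \<open>n\<close> satisfies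
      \<open>gcd d n = d\<close> and so represents its own class. The class of \<open>k = 0\<close>
      is represented by \<open>d = n\<close>.\<close>
    then have "f k = f d" if "gcd k n = d" for k
      using f[of k d] that by (auto simp: gcd_nat.absorb1)
    then show "(\<Sum>k\<in>{k \<in> {..<n}. gcd k n = d}. of_int (f k) * root_unity n ^ (k * h)) =
        of_int (f d) * (\<Sum>k | k < n \<and> gcd k n = d. root_unity n ^ (k * h))"
      by (auto simp: sum_distrib_left intro!: sum.cong)
  qed
  also have "\<dots> \<in> \<int>"
    by (intro Ints_sum Ints_mult sum_root_unity_gcd assms(1)) auto
  finally show ?thesis .
qed

subsection \<open>Atoms\<close>

lemma count_sum_repeat_mset_set:
  assumes "finite \<A>" "\<And>X. X \<in> \<A> \<Longrightarrow> finite X"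
  shows "count (\<Sum>X\<in>\<A>. repeat_mset (m X) (mset_set X)) x = (\<Sum>X | X \<in> \<A> \<and> x \<in> X. m X)"
proof -
  have "count (\<Sum>X\<in>\<A>. repeat_mset (m X) (mset_set X)) x = (\<Sum>X\<in>\<A>. if x \<in> X then m X else 0)"
    unfolding count_sum using assms(2) by (intro sum.cong) (auto simp: count_mset_set')
  then show ?thesis using assms(1) by (simp add: sum.inter_filter)
qed

text \<open>An element of \<open>H\<close> lies in its own atom and in no other, so the coefficient
  of that atom is the multiplicity of the element.\<close>

lemma mem_atom_cone_iff:
  assumes "finite H"
  shows "M \<in> atom_cone G H \<longleftrightarrow> set_mset M \<subseteq> H \<and>
    (\<forall>x\<in>H. \<forall>y\<in>H. generate G {x} = generate G {y} \<longrightarrow> count M x = count M y)"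
proof
  assume "M \<in> atom_cone G H"
  then obtain \<A> m where \<A>: "finite \<A>" "\<A> \<subseteq> atoms G H"
    and M: "M = (\<Sum>X\<in>\<A>. repeat_mset (m X) (mset_set X))"
    by (auto simp: atom_cone_def)
  have sub: "X \<subseteq> H" if "X \<in> \<A>" for X
    using that \<A>(2) by (auto simp: atoms_def atom_of_def)
  then have count: "count M x = (\<Sum>X | X \<in> \<A> \<and> x \<in> X. m X)" for x
    unfolding M using \<A>(1) assms finite_subset by (intro count_sum_repeat_mset_set) blast+
  have "x \<in> H" if "x \<in># M" for x
  proof (rule ccontr)
    assume "x \<notin> H"
    then have "{X. X \<in> \<A> \<and> x \<in> X} = {}" using sub by blast
    then have "count M x = 0" unfolding count by (simp only: sum.empty)
    with that show False by (metis not_in_iff)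
  qed
  moreover have "count M x = count M y"
    if "x \<in> H" "y \<in> H" "generate G {x} = generate G {y}" for x y
  proof -
    have "{X. X \<in> \<A> \<and> x \<in> X} = {X. X \<in> \<A> \<and> y \<in> X}"
      using that \<A>(2) by (auto simp: atoms_def atom_of_def)
    then show ?thesis by (simp add: count)
  qed
  ultimately show "set_mset M \<subseteq> H \<and>
    (\<forall>x\<in>H. \<forall>y\<in>H. generate G {x} = generate G {y} \<longrightarrow> count M x = count M y)"
    by blast
next
  assume *: "set_mset M \<subseteq> H \<and>
    (\<forall>x\<in>H. \<forall>y\<in>H. generate G {x} = generate G {y} \<longrightarrow> count M x = count M y)"
  \<comment> \<open>The coefficient of an atom is read off at an arbitrary member; constancy on
    atoms makes the choice irrelevant.\<close>
  define m where "m = (\<lambda>X. count M (SOME x. x \<in> X))"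
  have m: "m X = count M x" if "X \<in> atoms G H" "x \<in> X" for X x
  proof -
    have "(SOME x. x \<in> X) \<in> X" using that(2) by (rule someI)
    with that have "(SOME x. x \<in> X) \<in> H" "x \<in> H"
      "generate G {SOME x. x \<in> X} = generate G {x}"
      by (auto simp: atoms_def atom_of_def)
    with * show ?thesis unfolding m_def by blast
  qed
  have fin: "finite (atoms G H)" using assms by (simp add: atoms_def)
  have "M = (\<Sum>X\<in>atoms G H. repeat_mset (m X) (mset_set X))"
  proof (rule multiset_eqI)
    fix x
    have "count (\<Sum>X\<in>atoms G H. repeat_mset (m X) (mset_set X)) x =
        (\<Sum>X | X \<in> atoms G H \<and> x \<in> X. m X)"
      using assms fin
      by (intro count_sum_repeat_mset_set) (auto simp: atoms_def atom_of_def)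
    also have "\<dots> = count M x"
    proof (cases "x \<in> H")
      case True
      then have "{X. X \<in> atoms G H \<and> x \<in> X} = {atom_of G H x}"
        by (auto simp: atoms_def atom_of_def)
      moreover have "m (atom_of G H x) = count M x"
        using True by (intro m) (auto simp: atoms_def atom_of_def)
      ultimately show ?thesis by simp
    next
      case False
      then have "{X. X \<in> atoms G H \<and> x \<in> X} = {}"
        by (auto simp: atoms_def atom_of_def)
      moreover have "count M x = 0" using False * by (auto simp: count_eq_zero_iff)
      ultimately show ?thesis by (simp only: sum.empty)
    qed
    finally show "count M x = count (\<Sum>X\<in>atoms G H. repeat_mset (m X) (mset_set X)) x" by simp
  qed
  with fin show "M \<in> atom_cone G H" by (auto simp: atom_cone_def)
qed

section \<open>The Boolean algebra generated by subgroups\<close>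

context group
begin

lemma subgroup_boolean_algebra_Union:
  assumes "subgroup H G" "finite \<F>" "\<F> \<subseteq> subgroup_boolean_algebra G H"
  shows "\<Union>\<F> \<in> subgroup_boolean_algebra G H"
  using assms(2,3)
proof (induction \<F> rule: finite_induct)
  case empty
  have "H - H \<in> subgroup_boolean_algebra G H"
    using assms(1) by (intro subgroup_boolean_algebra.intros) auto
  then show ?case by simp
qed (auto intro: subgroup_boolean_algebra.union)

text \<open>
  The atom of \<open>x\<close> is the cyclic group generated by \<open>x\<close> without its proper cyclic subgroups.
\<close>
lemma atom_of_mem_subgroup_boolean_algebra:
  assumes H: "subgroup H G" "finite H" and "x \<in> H"
  shows "atom_of G H x \<in> subgroup_boolean_algebra G H"
proof -
  have cyc: "generate G {y} \<subseteq> H" "subgroup (generate G {y}) G" "y \<in> generate G {y}" if "y \<in> H" for y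
    using that generate_subgroup_incl[of "{y}" H] H(1) subgroup.subset[OF H(1)]
    by (auto intro!: generate_is_subgroup generate.incl)
  define \<F> where "\<F> = (\<lambda>y. generate G {y}) ` {y \<in> generate G {x}. generate G {y} \<noteq> generate G {x}}"
  have sub: "generate G {y} \<subseteq> generate G {z}" if "z \<in> H" "y \<in> generate G {z}" for y z
    using that cyc(2) by (intro generate_subgroup_incl) auto
  have "atom_of G H x = generate G {x} \<inter> (H - \<Union>\<F>)"
  proof (intro equalityI subsetI)
    fix y assume "y \<in> atom_of G H x"
    then have y: "y \<in> H" "generate G {y} = generate G {x}" by (auto simp: atom_of_def)
    have False if "z \<in> generate G {x}" "generate G {z} \<noteq> generate G {x}" "y \<in> generate G {z}" for z
      \<comment> \<open>If \<open>y\<close> generates \<open>generate G {x}\<close> and lies in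
        \<open>generate G {z}\<close>, then the two cyclic groups contain each other.\<close>
      using sub[of x z] sub[of z y] that y assms(3) cyc(1)[of x] by blast
    with y cyc(3)[of y] show "y \<in> generate G {x} \<inter> (H - \<Union>\<F>)"
      by (auto simp: \<F>_def)
  next
    fix y assume y: "y \<in> generate G {x} \<inter> (H - \<Union>\<F>)"
    then have "y \<in> generate G {y}" using cyc(3) by blast
    with y have "generate G {y} = generate G {x}" by (auto simp: \<F>_def)
    with y show "y \<in> atom_of G H x" by (simp add: atom_of_def)
  qed
  moreover have "\<Union>\<F> \<in> subgroup_boolean_algebra G H"
  proof (rule subgroup_boolean_algebra_Union[OF H(1)])
    show "finite \<F>"
      using finite_subset[OF cyc(1)[OF assms(3)] H(2)] by (simp add: \<F>_def)
    show "\<F> \<subseteq> subgroup_boolean_algebra G H"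
      using cyc cyc(1)[OF assms(3)]
      by (auto simp: \<F>_def intro!: subgroup_boolean_algebra.subgroup)
  qed
  ultimately show ?thesis
    using cyc[OF assms(3)]
    by (auto intro!: subgroup_boolean_algebra.inter subgroup_boolean_algebra.complement
        intro: subgroup_boolean_algebra.subgroup)
qed

text \<open>A subgroup containing \<open>x\<close> contains every generator of
  \<open>generate G {x}\<close>, and this closure property survives the Boolean operations; for
  complements it is used with \<open>x\<close> and \<open>y\<close> exchanged. Conversely,
  \<open>T\<close> is the finite union of the atoms of its elements.\<close>

lemma mem_subgroup_boolean_algebra_iff:
  assumes H: "subgroup H G" "finite H"
  shows "T \<in> subgroup_boolean_algebra G H \<longleftrightarrow> T \<subseteq> H \<and>
    (\<forall>x\<in>H. \<forall>y\<in>H. generate G {x} = generate G {y} \<longrightarrow> x \<in> T \<longrightarrow> y \<in> T)"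
proof
  assume "T \<in> subgroup_boolean_algebra G H"
  then show "T \<subseteq> H \<and>
    (\<forall>x\<in>H. \<forall>y\<in>H. generate G {x} = generate G {y} \<longrightarrow> x \<in> T \<longrightarrow> y \<in> T)"
  proof induction
    case (subgroup K)
    have "y \<in> K" if "y \<in> H" "generate G {x} = generate G {y}" "x \<in> K" for x y
      using that generate_subgroup_incl[of "{x}" K] subgroup(1) generate.incl[of y "{y}" G] by auto
    with subgroup show ?case by blast
  qed blast+
next
  assume T: "T \<subseteq> H \<and>
    (\<forall>x\<in>H. \<forall>y\<in>H. generate G {x} = generate G {y} \<longrightarrow> x \<in> T \<longrightarrow> y \<in> T)"
  have "T = \<Union>(atom_of G H ` T)"
  proof (intro equalityI subsetI)
    fix x assume "x \<in> T"
    with T show "x \<in> \<Union>(atom_of G H ` T)" by (auto simp: atom_of_def)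
  next
    fix y assume "y \<in> \<Union>(atom_of G H ` T)"
    then obtain x where "x \<in> T" "y \<in> H" "generate G {x} = generate G {y}"
      by (auto simp: atom_of_def)
    with T show "y \<in> T" by blast
  qed
  moreover have "\<Union>(atom_of G H ` T) \<in> subgroup_boolean_algebra G H"
    using T H finite_subset[of T H]
    by (intro subgroup_boolean_algebra_Union) (auto intro: atom_of_mem_subgroup_boolean_algebra)
  ultimately show "T \<in> subgroup_boolean_algebra G H" by simp
qed

end

subsection \<open>Rotations and characters\<close>

text \<open>The relation for the power \<open>n\<close> of the rotation gives one direction. The
  other, that no further powers collapse, rests on the action on the integers behind
  \<open>rot_pow_eqD\<close>.\<close>

lemma rot_pow_eq_iff:
  "rot n [^]\<^bsub>dihedral n\<^esub> (k::nat) = rot n [^]\<^bsub>dihedral n\<^esub> (l::nat) \<longleftrightarrow> [k = l] (mod n)"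
proof
  assume "rot n [^]\<^bsub>dihedral n\<^esub> k = rot n [^]\<^bsub>dihedral n\<^esub> l"
  then have "[int k = int l] (mod int n)"
    unfolding cong_iff_dvd_diff by (rule rot_pow_eqD)
  then show "[k = l] (mod n)" unfolding cong_int_iff .
next
  interpret group "dihedral n" by (rule group_dihedral)
  have one: "rot n [^]\<^bsub>dihedral n\<^esub> n = \<one>\<^bsub>dihedral n\<^esub>"
    unfolding rot_pow unfolding dihedral_def one_presented_group pres_class_eq_iff
    by (rule pres_eq.rel) (simp add: dihedral_rels_def)
  have "rot n [^]\<^bsub>dihedral n\<^esub> (m mod n) = rot n [^]\<^bsub>dihedral n\<^esub> m" for m
  proof -
    have "rot n [^]\<^bsub>dihedral n\<^esub> m = rot n [^]\<^bsub>dihedral n\<^esub> (n * (m div n) + m mod n)" by simp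
    also have "\<dots> = rot n [^]\<^bsub>dihedral n\<^esub> (m mod n)"
      by (simp only: nat_pow_mult[symmetric] nat_pow_pow[symmetric] rot_in_carrier one nat_pow_one
          nat_pow_closed l_one)
    finally show ?thesis by simp
  qed
  moreover assume "[k = l] (mod n)"
  ultimately show "rot n [^]\<^bsub>dihedral n\<^esub> k = rot n [^]\<^bsub>dihedral n\<^esub> l"
    by (metis cong_def)
qed

text \<open>
  Inverses of powers of \<open>rot n\<close> are written with the exponent \<open>n - 1\<close>, which represents \<open>-1\<close>
  modulo \<open>n\<close>; in this way all exponents are natural numbers.
\<close>
lemma inv_rot_pow:
  assumes "n \<ge> 1"
  shows "inv\<^bsub>dihedral n\<^esub> (rot n [^]\<^bsub>dihedral n\<^esub> (k::nat)) =
    rot n [^]\<^bsub>dihedral n\<^esub> ((n - 1) * k)"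
proof -
  interpret group "dihedral n" by (rule group_dihedral)
  have "(n - 1) * k + k = n * k" using assms by (cases n) simp_all
  then have "rot n [^]\<^bsub>dihedral n\<^esub> ((n - 1) * k + k) = rot n [^]\<^bsub>dihedral n\<^esub> (0::nat)"
    unfolding rot_pow_eq_iff by (simp add: cong_0_iff)
  then have "rot n [^]\<^bsub>dihedral n\<^esub> ((n - 1) * k) \<otimes>\<^bsub>dihedral n\<^esub> rot n [^]\<^bsub>dihedral n\<^esub> k =
      \<one>\<^bsub>dihedral n\<^esub>"
    by (simp add: nat_pow_mult rot_in_carrier)
  then show ?thesis by (rule inv_equality) (simp_all add: rot_in_carrier)
qed

text \<open>Nonnegative exponents suffice because the inverse is itself the power with exponent
  \<open>n - 1\<close>.\<close>

lemma generate_rot_pow: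
  assumes "n \<ge> 1"
  shows "generate (dihedral n) {rot n [^]\<^bsub>dihedral n\<^esub> (k::nat)} =
    (\<lambda>j. rot n [^]\<^bsub>dihedral n\<^esub> (k * j)) ` (UNIV :: nat set)"
proof
  interpret group "dihedral n" by (rule group_dihedral)
  note [simp] = rot_in_carrier
  show "(\<lambda>j. rot n [^]\<^bsub>dihedral n\<^esub> (k * j)) ` UNIV \<subseteq> generate (dihedral n) {rot n [^]\<^bsub>dihedral n\<^esub> k}"
  proof (intro image_subsetI)
    fix j
    show "rot n [^]\<^bsub>dihedral n\<^esub> (k * j) \<in> generate (dihedral n) {rot n [^]\<^bsub>dihedral n\<^esub> k}"
    proof (induction j)
      case 0
      show ?case by (simp add: generate.one)
    next
      case (Suc j)
      have "rot n [^]\<^bsub>dihedral n\<^esub> (k * Suc j) =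
          rot n [^]\<^bsub>dihedral n\<^esub> k \<otimes>\<^bsub>dihedral n\<^esub> rot n [^]\<^bsub>dihedral n\<^esub> (k * j)"
        by (simp add: nat_pow_mult)
      with Suc show ?case by (simp add: generate.eng generate.incl)
    qed
  qed
  show "generate (dihedral n) {rot n [^]\<^bsub>dihedral n\<^esub> k} \<subseteq> (\<lambda>j. rot n [^]\<^bsub>dihedral n\<^esub> (k * j)) ` UNIV"
  proof
    fix x assume "x \<in> generate (dihedral n) {rot n [^]\<^bsub>dihedral n\<^esub> k}"
    then have "\<exists>j. x = rot n [^]\<^bsub>dihedral n\<^esub> (k * j)"
    proof induction
      case one
      then show ?case by (intro exI[of _ 0]) simp
    next
      case (incl h)
      then show ?case by (intro exI[of _ 1]) simp
    next
      case (inv h)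
      then show ?case using inv_rot_pow[OF assms, of k]
        by (intro exI[of _ "n - 1"]) (simp add: mult.commute)
    next
      case (eng h1 h2)
      then obtain i j where "h1 = rot n [^]\<^bsub>dihedral n\<^esub> (k * i)" "h2 = rot n [^]\<^bsub>dihedral n\<^esub> (k * j)"
        by blast
      then show ?case by (intro exI[of _ "i + j"]) (simp add: nat_pow_mult distrib_left)
    qed
    then show "x \<in> (\<lambda>j. rot n [^]\<^bsub>dihedral n\<^esub> (k * j)) ` UNIV" by blast
  qed
qed

text \<open>Membership is solvability of the linear congruence \<open>k * j = l\<close> modulo
  \<open>n\<close>, which Bezout's identity decides.\<close>

lemma rot_pow_mem_generate_iff:
  assumes "n \<ge> 1"
  shows "rot n [^]\<^bsub>dihedral n\<^esub> (l::nat) \<in> generate (dihedral n) {rot n [^]\<^bsub>dihedral n\<^esub> (k::nat)}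
    \<longleftrightarrow> gcd k n dvd l"
proof -
  have "rot n [^]\<^bsub>dihedral n\<^esub> l \<in> generate (dihedral n) {rot n [^]\<^bsub>dihedral n\<^esub> k}
      \<longleftrightarrow> (\<exists>j. [k * j = l] (mod n))"
    unfolding generate_rot_pow[OF assms] image_iff rot_pow_eq_iff by (auto simp: cong_sym_eq)
  also have "\<dots> \<longleftrightarrow> gcd k n dvd l"
  proof
    assume "\<exists>j. [k * j = l] (mod n)"
    then obtain j where "[k * j = l] (mod n)" ..
    then have "[k * j = l] (mod gcd k n)"
      by (rule cong_dvd_modulus_nat) simp
    then show "gcd k n dvd l" using cong_dvd_iff by fastforce
  next
    assume "gcd k n dvd l"
    then show "\<exists>j. [k * j = l] (mod n)" using cong_solve_nat[of k n] cong_scalar_left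
      by (metis dvd_div_mult_self mult.left_commute)
  qed
  finally show ?thesis .
qed

text \<open>This identifies the atoms with the gcd classes of exponents: each generator lies in the
  other cyclic group exactly when the two gcds divide each other.\<close>

lemma generate_rot_pow_eq_iff:
  assumes "n \<ge> 1"
  shows "generate (dihedral n) {rot n [^]\<^bsub>dihedral n\<^esub> (k::nat)} =
    generate (dihedral n) {rot n [^]\<^bsub>dihedral n\<^esub> (l::nat)} \<longleftrightarrow> gcd k n = gcd l n"
proof
  interpret group "dihedral n" by (rule group_dihedral)
  assume eq: "generate (dihedral n) {rot n [^]\<^bsub>dihedral n\<^esub> k} =
    generate (dihedral n) {rot n [^]\<^bsub>dihedral n\<^esub> l}"
  have "rot n [^]\<^bsub>dihedral n\<^esub> k \<in> generate (dihedral n) {rot n [^]\<^bsub>dihedral n\<^esub> l}"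
    "rot n [^]\<^bsub>dihedral n\<^esub> l \<in> generate (dihedral n) {rot n [^]\<^bsub>dihedral n\<^esub> k}"
    using generate.incl[of "rot n [^]\<^bsub>dihedral n\<^esub> k" "{rot n [^]\<^bsub>dihedral n\<^esub> k}"]
      generate.incl[of "rot n [^]\<^bsub>dihedral n\<^esub> l" "{rot n [^]\<^bsub>dihedral n\<^esub> l}"] eq
    by auto
  then show "gcd k n = gcd l n"
    unfolding rot_pow_mem_generate_iff[OF assms] by (intro dvd_antisym) auto
next
  interpret group "dihedral n" by (rule group_dihedral)
  assume eq: "gcd k n = gcd l n"
  have "generate (dihedral n) {rot n [^]\<^bsub>dihedral n\<^esub> k} \<subseteq>
      generate (dihedral n) {rot n [^]\<^bsub>dihedral n\<^esub> l}" if "gcd k n = gcd l n" for k l :: nat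
    using that rot_pow_mem_generate_iff[OF assms, of k l]
    by (intro generate_subgroup_incl generate_is_subgroup) (auto simp: rot_in_carrier simp flip: that)
  with eq show "generate (dihedral n) {rot n [^]\<^bsub>dihedral n\<^esub> k} =
    generate (dihedral n) {rot n [^]\<^bsub>dihedral n\<^esub> l}" by (intro equalityI) simp_all
qed

lemma bij_betw_rotations:
  assumes "n \<ge> 1"
  shows "bij_betw (\<lambda>k. rot n [^]\<^bsub>dihedral n\<^esub> (k::nat)) {..<n} (rotations n)"
proof -
  interpret group "dihedral n" by (rule group_dihedral)
  have rot: "rotations n = range (\<lambda>k::nat. rot n [^]\<^bsub>dihedral n\<^esub> k)"
    using generate_rot_pow[OF assms, of 1] by (simp add: rotations_def rot_in_carrier)
  have "rot n [^]\<^bsub>dihedral n\<^esub> k \<in> (\<lambda>k. rot n [^]\<^bsub>dihedral n\<^esub> k) ` {..<n}" for k :: nat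
  proof (rule image_eqI)
    show "rot n [^]\<^bsub>dihedral n\<^esub> k = rot n [^]\<^bsub>dihedral n\<^esub> (k mod n)"
      by (simp add: rot_pow_eq_iff cong_def)
  qed (use assms in simp)
  then have "(\<lambda>k. rot n [^]\<^bsub>dihedral n\<^esub> k) ` {..<n} = rotations n"
    unfolding rot by auto
  then show ?thesis
    by (auto simp: bij_betw_def inj_on_def rot_pow_eq_iff cong_def)
qed

lemma subgroup_rotations: "subgroup (rotations n) (dihedral n)"
  unfolding rotations_def
  by (rule group.generate_is_subgroup[OF group_dihedral]) (simp add: rot_in_carrier)

section \<open>Character sums as Fourier transforms, and the theorem\<close>

lemma sum_mset_eq_sum_count:
  fixes f :: "'a \<Rightarrow> 'b :: comm_semiring_1"
  assumes "finite A" "set_mset M \<subseteq> A"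
  shows "(\<Sum>x\<in>#M. f x) = (\<Sum>x\<in>A. of_nat (count M x) * f x)"
  using assms(2)
proof (induction M)
  case (add y M)
  then have "(\<Sum>x\<in>A. of_nat (count (add_mset y M) x) * f x) =
      (\<Sum>x\<in>A. (if x = y then f x else 0) + of_nat (count M x) * f x)"
    by (intro sum.cong) (auto simp: algebra_simps)
  with add assms(1) show ?case by (simp add: sum.distrib)
qed simp

text \<open>The cosine splits into \<open>w^(k*h)\<close> and its inverse for
  \<open>w = root_unity n\<close>. Inverse-closedness makes the multiplicity function even, so both
  halves contribute the same transform, whence the factor 2.\<close>

lemma of_real_sum_mset_dihedral_chi:
  assumes n: "n \<ge> 1" and M: "set_mset M \<subseteq> rotations n" "inverse_closed (dihedral n) M"
  shows "complex_of_real (\<Sum>s\<in>#M. dihedral_chi n h s) =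
    dft n (\<lambda>k. 2 * int (count M (rot n [^]\<^bsub>dihedral n\<^esub> k))) h"
proof -
  interpret group "dihedral n" by (rule group_dihedral)
  define f where "f k = count M (rot n [^]\<^bsub>dihedral n\<^esub> k)" for k :: nat
  let ?w = "root_unity n"
  have per: "f (k mod n) = f k" for k
    using rot_pow_eq_iff[of n "k mod n" k] by (simp add: f_def)
  have neg: "f ((n - 1) * k) = f k" for k
    using M(2) unfolding f_def inv_rot_pow[OF n, symmetric] inverse_closed_def
    by (simp add: rot_in_carrier)
  have cos: "complex_of_real (2 * cos (2 * real k * real h * pi / real n)) =
      ?w ^ (k * h) + ?w ^ ((n - 1) * k * h)" for k
  proof -
    have "?w ^ ((n - 1) * k * h) * ?w ^ (k * h) = ?w ^ (n * (k * h))"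
      using n by (cases n) (simp_all add: algebra_simps flip: power_add)
    also have "\<dots> = 1" using n by (simp add: root_unity_power_eq_1_iff)
    finally have "?w ^ ((n - 1) * k * h) = inverse (?w ^ (k * h))"
      by (metis inverse_unique mult.commute)
    then show ?thesis
      by (simp add: root_unity_power complex_eq_iff mult_ac)
  qed
  have "(\<Sum>s\<in>#M. dihedral_chi n h s) = (\<Sum>s\<in>rotations n. real (count M s) * dihedral_chi n h s)"
    using bij_betw_finite[OF bij_betw_rotations[OF n]] M(1) by (intro sum_mset_eq_sum_count) simp_all
  also have "\<dots> = (\<Sum>k<n. real (f k) * (2 * cos (2 * real k * real h * pi / real n)))"
    unfolding sum.reindex_bij_betw[OF bij_betw_rotations[OF n], symmetric] f_def
      dihedral_chi_rot_pow[OF n] ..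
  also have "complex_of_real \<dots> = (\<Sum>k<n. of_nat (f k) * (?w ^ (k * h) + ?w ^ ((n - 1) * k * h)))"
    unfolding of_real_sum of_real_mult[of "real (f _)"] cos by simp
  also have "\<dots> = (\<Sum>k<n. of_nat (f k) * ?w ^ (k * h)) +
      (\<Sum>k<n. of_nat (f k) * ?w ^ ((n - 1) * k * h))"
    by (simp only: distrib_left sum.distrib)
  also have "(\<Sum>k<n. of_nat (f k) * ?w ^ ((n - 1) * k * h)) = dft n (\<lambda>k. int (f k)) ((n - 1) * h)"
    by (simp add: dft_def mult_ac)
  also have "\<dots> = dft n (\<lambda>k. int (f k)) h"
    using n per neg by (intro dft_neg) simp_all
  finally show ?thesis
    by (simp add: dft_def f_def sum_distrib_left mult_ac flip: sum.distrib)
qed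

lemma dihedral_chi_int_iff_mem_atom_cone:
  assumes n: "n \<ge> 1" and M: "set_mset M \<subseteq> rotations n" "inverse_closed (dihedral n) M"
  shows "(\<forall>h\<in>{1..(n - 1) div 2}. (\<Sum>s\<in>#M. dihedral_chi n h s) \<in> \<int>) \<longleftrightarrow>
    M \<in> atom_cone (dihedral n) (rotations n)"
proof -
  interpret group "dihedral n" by (rule group_dihedral)
  define F where "F k = 2 * int (count M (rot n [^]\<^bsub>dihedral n\<^esub> k))" for k :: nat
  have n0: "n > 0" using n by simp
  have per: "F (k mod n) = F k" for k
    using rot_pow_eq_iff[of n "k mod n" k] by (simp add: F_def)
  have chi: "(\<Sum>s\<in>#M. dihedral_chi n h s) \<in> \<int> \<longleftrightarrow> dft n F h \<in> \<int>" for h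
    unfolding F_def of_real_sum_mset_dihedral_chi[OF assms, symmetric] of_real_in_Ints_iff ..
  have "F ((n - 1) * k) = F k" for k
    using M(2) unfolding F_def inv_rot_pow[OF n, symmetric] inverse_closed_def
    by (simp add: rot_in_carrier)
  then have neg: "dft n F ((n - 1) * h) = dft n F h" for h
    using n0 per by (intro dft_neg) simp_all
  have fin: "finite (rotations n)"
    using bij_betw_finite[OF bij_betw_rotations[OF n]] by simp
  have bij: "rotations n = (\<lambda>k. rot n [^]\<^bsub>dihedral n\<^esub> k) ` {..<n}"
    using bij_betw_rotations[OF n] by (simp add: bij_betw_def)
  have "M \<in> atom_cone (dihedral n) (rotations n) \<longleftrightarrow>
      (\<forall>k<n. \<forall>l<n. gcd k n = gcd l n \<longrightarrow> F k = F l)"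
    using M(1) unfolding mem_atom_cone_iff[OF fin]
    by (auto simp: bij generate_rot_pow_eq_iff[OF n] F_def)
  \<comment> \<open>Periodicity extends the condition from residues to all exponents, the form that
    the lemmas on \<open>dft\<close> require.\<close>
  also have "\<dots> \<longleftrightarrow> (\<forall>k l. gcd k n = gcd l n \<longrightarrow> F k = F l)"
  proof (intro iffI allI impI)
    fix k l assume *: "\<forall>k<n. \<forall>l<n. gcd k n = gcd l n \<longrightarrow> F k = F l" "gcd k n = gcd l n"
    have "F (k mod n) = F (l mod n)" using * n0 by (simp add: gcd.commute flip: gcd_red_nat)
    then show "F k = F l" by (simp only: per)
  next
    fix k l assume "\<forall>k l. gcd k n = gcd l n \<longrightarrow> F k = F l" "gcd k n = gcd l n"
    then show "F k = F l" by blast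
  qed
  also have "\<dots> \<longleftrightarrow> (\<forall>h\<in>{1..(n - 1) div 2}. dft n F h \<in> \<int>)"
  proof (intro iffI ballI allI impI)
    fix h assume "\<forall>k l. gcd k n = gcd l n \<longrightarrow> F k = F l"
    then show "dft n F h \<in> \<int>" using n0 by (intro dft_int_if_gcd) blast+
  next
    fix k l assume int: "\<forall>h\<in>{1..(n - 1) div 2}. dft n F h \<in> \<int>" and "gcd k n = gcd l n"
    \<comment> \<open>The hypothesis omits \<open>h = 0\<close> and, for even \<open>n\<close>,
      \<open>h = n / 2\<close>. There \<open>root_unity n ^ h\<close> is 1 or -1, so integrality is
      automatic.\<close>
    have small: "dft n F h \<in> \<int>" if "2 * h \<le> n" for h
    proof -
      consider "h = 0" | "2 * h = n" | "h \<in> {1..(n - 1) div 2}"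
        using \<open>2 * h \<le> n\<close> n by fastforce
      then show ?thesis
      proof cases
        case 1
        then show ?thesis by (simp add: dft_def Ints_sum)
      next
        case 2
        then have "root_unity n ^ h = -1"
          using n0 by (simp add: root_unity_power complex_eq_iff flip: 2)
        moreover have "dft n F h = (\<Sum>k<n. of_int (F k) * (root_unity n ^ h) ^ k)"
          by (simp add: dft_def mult.commute flip: power_mult)
        ultimately show ?thesis by (simp add: Ints_sum Ints_mult Ints_power)
      qed (use int in blast)
    qed
    have "dft n F h \<in> \<int>" for h
    proof (cases "2 * (h mod n) \<le> n")
      case True
      then have "dft n F (h mod n) \<in> \<int>" by (rule small)
      then show ?thesis using dft_cong[OF n0, of "h mod n" h] by simp
    next
      case False
      \<comment> \<open>Residues above \<open>n / 2\<close> are reflected to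
        \<open>n - h mod n\<close>, which represents \<open>-h\<close>; evenness of the transform
        then reduces to \<open>small\<close>.\<close>
      have "[(n - 1) * h = n - h mod n] (mod n)"
      proof -
        have "[(n - 1) * h + h = n * h] (mod n)"
          using n by (cases n) (simp_all add: add.commute)
        moreover have "[(n - h mod n) + h = n * h] (mod n)"
        proof -
          have "[(n - h mod n) + h = (n - h mod n) + h mod n] (mod n)"
            by (intro cong_add) simp_all
          also have "(n - h mod n) + h mod n = n" using n0 by simp
          also have "[n = n * h] (mod n)" by (simp add: cong_def)
          finally show ?thesis .
        qed
        ultimately show ?thesis by (metis cong_add_rcancel_nat cong_sym cong_trans)
      qed
      then have "dft n F h = dft n F (n - h mod n)"
        using neg[of h] dft_cong[OF n0] by metis
      then show ?thesis using False small[of "n - h mod n"] by simp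
    qed
    then show "F k = F l"
      using \<open>gcd k n = gcd l n\<close> by (rule eq_if_dft_int[where f = F, OF n0 per])
  qed
  finally show ?thesis by (simp add: chi)
qed

theorem theorem3p2:
  fixes n :: nat and M :: "dihedral_gen word set multiset"
  assumes "n \<ge> 1"
    and "set_mset M \<subseteq> rotations n"
    and "inverse_closed (dihedral n) M"
  shows "((\<forall>h\<in>{1..(n - 1) div 2}. (\<Sum>s\<in>#M. dihedral_chi n h s) \<in> \<int>) \<longleftrightarrow>
            M \<in> atom_cone (dihedral n) (rotations n)) \<and>
         ((\<forall>h\<in>{1..(n - 1) div 2}. (\<Sum>s\<in>set_mset M. dihedral_chi n h s) \<in> \<int>) \<longleftrightarrow>
            set_mset M \<in> subgroup_boolean_algebra (dihedral n) (rotations n))"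
proof
  show "(\<forall>h\<in>{1..(n - 1) div 2}. (\<Sum>s\<in>#M. dihedral_chi n h s) \<in> \<int>) \<longleftrightarrow>
      M \<in> atom_cone (dihedral n) (rotations n)"
    using assms by (rule dihedral_chi_int_iff_mem_atom_cone)
next
  \<comment> \<open>The second equivalence is the first one for the multiset with multiplicities 0
    and 1 supported on the same set: constancy on atoms then says that the set is a union of
    atoms.\<close>
  let ?T = "mset_set (set_mset M)"
  have fin: "finite (rotations n)"
    using bij_betw_finite[OF bij_betw_rotations[OF assms(1)]] by simp
  have count: "count ?T s = (if s \<in># M then 1 else 0)" for s
    by (simp add: count_mset_set')
  have "inverse_closed (dihedral n) ?T"
    using assms(3) unfolding inverse_closed_def count by (metis not_in_iff)
  then have "(\<forall>h\<in>{1..(n - 1) div 2}. (\<Sum>s\<in>#?T. dihedral_chi n h s) \<in> \<int>) \<longleftrightarrow>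
      ?T \<in> atom_cone (dihedral n) (rotations n)"
    using assms by (intro dihedral_chi_int_iff_mem_atom_cone) simp_all
  also have "\<dots> \<longleftrightarrow> set_mset M \<in> subgroup_boolean_algebra (dihedral n) (rotations n)"
    unfolding mem_atom_cone_iff[OF fin] count
      group.mem_subgroup_boolean_algebra_iff[OF group_dihedral subgroup_rotations fin]
    by (auto split: if_splits)
  finally show "(\<forall>h\<in>{1..(n - 1) div 2}. (\<Sum>s\<in>set_mset M. dihedral_chi n h s) \<in> \<int>) \<longleftrightarrow>
      set_mset M \<in> subgroup_boolean_algebra (dihedral n) (rotations n)"
    by (simp add: sum_unfold_sum_mset)
qed

end
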